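(* Let $q\ge 2$ and $n\ge 1$ be integers, let $\mathscr{A}=\{0,1,\dots,q-1\}$, let $\mathscr{R}$ be a commutative ring with unit, and let $\mathsf{R}_1,\dots,\mathsf{R}_n$ be $q\times q$ matrices over $\mathscr{R}$, $\mathsf{R}_\nu=\left(\mathsf{r}_{\nu,i}^{j}\right)_{(i,j)\in\mathscr{A}^2}$ (row index $i$, column index $j$). Let $X=(X(w))_{w\in\mathscr{A}^n}$ be a vector with entries in $\mathscr{R}$, regarded as a function on $\mathscr{A}^n$. Define functions $X_0,X_1,\dots,X_n$ on $\mathscr{A}^n$ by $X_0=X$ and, for $1\le m\le n$, $$X_m(viw)=\sum_{j\in\mathscr{A}}\mathsf{r}_{m,i}^{j}\,X_{m-1}(jvw)\qquad\text{for all } i\in\mathscr{A},\ v\in\mathscr{A}^{n-m},\ w\in\mathscr{A}^{m-1}.$$ Then, for every $0\le m\le n$, every $v\in\mathscr{A}^{n-m}$ and every $w\in\mathscr{A}^m$, $$X_m(v\overleftarrow{w})=\sum_{u\in\mathscr{A}^m}\mathsf{w}_w^{u}\,X_0(uv).$$ In particular, for every $w\in\mathscr{A}^n$, $$X_n(\overleftarrow{w})=\sum_{u\in\mathscr{A}^n}\mathsf{w}_w^{u}\,X(u).$$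
   Context: $\mathscr{A}^m$ is the set of words of length $m$ on the alphabet $\mathscr{A}$ ($\mathscr{A}^0$ contains only the empty word). Juxtaposition of words and letters denotes concatenation. For a word $w=w_1w_2\cdots w_m$, $\overleftarrow{w}=w_mw_{m-1}\cdots w_1$ denotes the reversed word (the empty word is its own reverse). For words $v=v_1\cdots v_m$ and $w=w_1\cdots w_m$ in $\mathscr{A}^m$ with $0\le m\le n$, set $$\mathsf{w}_v^{w}=\prod_{j=1}^{m}\mathsf{r}_{j,v_j}^{w_j},$$ which equals $1$ when $m=0$ (empty product). For $m=n$, the matrix $(\mathsf{w}_v^w)_{v,w\in\mathscr{A}^n}$ is the tensor product $\mathsf{R}_1\otimes\cdots\otimes\mathsf{R}_n$. *)

theory Defs
  imports "Jordan_Normal_Form.Matrix"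
begin

definition words :: "nat \<Rightarrow> nat \<Rightarrow> nat list set" where
  "words q m = {w. set w \<subseteq> {..<q} \<and> length w = m}"

lemma finite_words: "finite (words q m)"
  by (simp add: words_def finite_lists_length_eq)

text \<open>The entry of the matrix \<open>R j\<close> in row \<open>v\<^sub>j\<close> and column \<open>w\<^sub>j\<close> is multiplied over
  all positions \<open>j\<close>. Matrices and positions are counted from 1, list entries from 0.
  The arguments are the lower word \<open>v\<close> (rows) and then the upper word \<open>w\<close> (columns),
  which are of equal length.\<close>

definition word_weight ::
    "(nat \<Rightarrow> 'a :: comm_monoid_mult mat) \<Rightarrow> nat list \<Rightarrow> nat list \<Rightarrow> 'a" where
  "word_weight R v w = (\<Prod>j = 1..length v. R j $$ (v ! (j - 1), w ! (j - 1)))"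

text \<open>The sort \<open>{comm_ring, comm_monoid_mult}\<close> is that of commutative rings with unit,
  the zero ring included; \<open>comm_ring_1\<close> would in addition require \<open>0 \<noteq> 1\<close>.

  The following predicate holds if the restrictions of \<open>Y 0, \<dots>, Y n\<close> to words of length \<open>n\<close>
  are the functions obtained from \<open>X\<close> by the recursion. Values of \<open>X\<close> and \<open>Y m\<close> at other lists
  are irrelevant. Such a family exists for all data, and is unique on \<open>words q n\<close>.\<close>

definition transform_family ::
    "nat \<Rightarrow> nat \<Rightarrow> (nat \<Rightarrow> 'a mat) \<Rightarrow> (nat list \<Rightarrow> 'a) \<Rightarrow>
     (nat \<Rightarrow> nat list \<Rightarrow> 'a :: {comm_ring, comm_monoid_mult}) \<Rightarrow> bool" where
  "transform_family q n R X Y \<longleftrightarrow>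
     (\<forall>w \<in> words q n. Y 0 w = X w) \<and>
     (\<forall>m \<in> {1..n}. \<forall>i \<in> {..<q}. \<forall>v \<in> words q (n - m). \<forall>w \<in> words q (m - 1).
        Y m (v @ [i] @ w) = (\<Sum>j<q. R m $$ (i, j) * Y (m - 1) ([j] @ v @ w)))"

lemma transform_family_exists: "\<exists>Y. transform_family q n R X Y"
proof -
  define Y where "Y = rec_nat X (\<lambda>k F x. \<Sum>j<q. R (Suc k) $$ (x ! (n - Suc k), j) *
      F (j # take (n - Suc k) x @ drop (Suc (n - Suc k)) x))"
  have "Y m (v @ [i] @ w) = (\<Sum>j<q. R m $$ (i, j) * Y (m - 1) ([j] @ v @ w))"
    if "m \<in> {1..n}" "v \<in> words q (n - m)" for m i v w
  proof -
    from that obtain k where "m = Suc k" by (cases m) auto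
    with that show ?thesis by (simp add: Y_def words_def nth_append)
  qed
  moreover have "Y 0 = X" by (simp add: Y_def)
  ultimately have "transform_family q n R X Y" by (simp add: transform_family_def)
  then show ?thesis by blast
qed

lemma transform_family_unique:
  assumes Y: "transform_family q n R X Y" and Z: "transform_family q n R X Z"
  shows "m \<le> n \<Longrightarrow> x \<in> words q n \<Longrightarrow> Y m x = Z m x"
proof (induction m arbitrary: x)
  case 0
  then show ?case using Y Z by (simp add: transform_family_def)
next
  case (Suc k)
  define v i w where "v = take (n - Suc k) x" and "i = x ! (n - Suc k)"
    and "w = drop (Suc (n - Suc k)) x"
  have len: "length x = n" and sub: "set x \<subseteq> {..<q}" using Suc.prems by (auto simp: words_def)
  have x: "x = v @ [i] @ w"
    unfolding v_def i_def w_def using len Suc.prems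
    by (metis append_Cons append_Nil diff_less id_take_nth_drop less_le_trans zero_less_Suc)
  have v: "v \<in> words q (n - Suc k)" and w: "w \<in> words q k"
    using len sub Suc.prems by (auto simp: words_def v_def w_def
      dest: in_set_takeD in_set_dropD)
  have i: "i < q" using sub x by auto
  have eq: "F (Suc k) x = (\<Sum>j<q. R (Suc k) $$ (i, j) * F k ([j] @ v @ w))"
    if "transform_family q n R X F" for F
  proof -
    have "Suc k \<in> {1..n}" and "w \<in> words q (Suc k - 1)" and "i \<in> {..<q}"
      using Suc.prems w i by auto
    with that v have "F (Suc k) (v @ [i] @ w) =
        (\<Sum>j<q. R (Suc k) $$ (i, j) * F (Suc k - 1) ([j] @ v @ w))"
      unfolding transform_family_def by blast
    then show ?thesis unfolding x by simp
  qed
  have "Y k ([j] @ v @ w) = Z k ([j] @ v @ w)" if "j < q" for j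
    using that v w Suc.prems by (intro Suc.IH) (auto simp: words_def)
  then show ?case by (simp add: eq[OF Y] eq[OF Z])
qed

end

theory Submission
  imports Defs
begin

text \<open>Step \<open>m\<close> of the recursion takes the first letter of a word, transforms it by the \<open>m\<close>-th
  matrix, and puts the result directly before the letters that were treated earlier. Hence after
  \<open>m\<close> steps the first \<open>m\<close> letters have moved to the end, in reversed order, each transformed by
  the matrix of its original position; the remaining \<open>n - m\<close> letters have only been shifted.

  In the induction on \<open>m\<close>, the last letter \<open>i\<close> of a lower word \<open>w @ [i]\<close> is the first letter of
  its reverse, so it is the letter on which step \<open>Suc m\<close> acts. This step replaces \<open>i\<close> by a
  summation letter \<open>j\<close> at the front of the untreated part, and the induction hypothesis for the
  untreated word \<open>j # v\<close> then puts \<open>j\<close> right after the upper word \<open>u\<close>. Thus both words grow at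
  their right end (lemma \<open>word_weight_snoc\<close>), and the double sum over \<open>u\<close> and \<open>j\<close> is the sum over
  the words \<open>u @ [j]\<close> (lemma \<open>sum_words_Suc\<close>).\<close>

lemma words_0: "words q 0 = {[]}"
  by (auto simp: words_def)

lemma sum_words_Suc: "(\<Sum>x \<in> words q (Suc m). f x) = (\<Sum>u \<in> words q m. \<Sum>j<q. f (u @ [j]))"
proof -
  have "bij_betw (\<lambda>(u, j). u @ [j]) (words q m \<times> {..<q}) (words q (Suc m))"
  proof (rule bij_betw_byWitness[where f' = "\<lambda>x. (butlast x, last x)"])
    show "\<forall>x \<in> words q (Suc m). (\<lambda>(u, j). u @ [j]) (butlast x, last x) = x"
      by (auto simp: words_def intro!: append_butlast_last_id)
    show "(\<lambda>x. (butlast x, last x)) ` words q (Suc m) \<subseteq> words q m \<times> {..<q}"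
    proof
      fix p assume "p \<in> (\<lambda>x. (butlast x, last x)) ` words q (Suc m)"
      then obtain x where x: "x \<in> words q (Suc m)" and p: "p = (butlast x, last x)" by auto
      then have "x \<noteq> []" by (auto simp: words_def)
      then obtain u j where "x = u @ [j]" by (cases x rule: rev_cases) auto
      with x p show "p \<in> words q m \<times> {..<q}" by (auto simp: words_def)
    qed
  qed (auto simp: words_def)
  then show ?thesis
    by (simp add: sum.cartesian_product sum.reindex_bij_betw[symmetric] case_prod_unfold)
qed

lemma word_weight_snoc:
  assumes "length u = length w"
  shows "word_weight R (w @ [i]) (u @ [j]) = word_weight R w u * R (Suc (length w)) $$ (i, j)"
proof -
  have "(\<Prod>k = 1..length w. R k $$ ((w @ [i]) ! (k - 1), (u @ [j]) ! (k - 1)))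
      = (\<Prod>k = 1..length w. R k $$ (w ! (k - 1), u ! (k - 1)))"
    using assms by (intro prod.cong) (auto simp: nth_append)
  moreover have "(w @ [i]) ! length w = i" and "(u @ [j]) ! length w = j"
    using assms by (simp_all add: nth_append)
  ultimately show ?thesis by (simp add: word_weight_def)
qed

text \<open>The untreated part \<open>v\<close> is arbitrary in the induction, because the step lengthens it by the
  summation letter \<open>j\<close>.\<close>

lemma transform_family_expand:
  fixes R :: "nat \<Rightarrow> 'a :: {comm_ring, comm_monoid_mult} mat"
  assumes Y: "transform_family q n R X Y"
  shows "m \<le> n \<Longrightarrow> v \<in> words q (n - m) \<Longrightarrow> w \<in> words q m \<Longrightarrow>
    Y m (v @ rev w) = (\<Sum>u \<in> words q m. word_weight R w u * Y 0 (u @ v))"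
proof (induction m arbitrary: v w)
  case 0
  then show ?case by (simp add: words_0 word_weight_def)
next
  case (Suc m)
  from Suc.prems(3) have "w \<noteq> []" by (auto simp: words_def)
  then obtain w' i where w: "w = w' @ [i]" by (cases w rule: rev_cases) auto
  have w': "w' \<in> words q m" "rev w' \<in> words q (Suc m - 1)" and i: "i \<in> {..<q}"
    using Suc.prems(3) by (auto simp: words_def w)
  have "Suc m \<in> {1..n}" using Suc.prems(1) by simp
  with Y Suc.prems(2) w'(2) i have "Y (Suc m) (v @ [i] @ rev w') =
      (\<Sum>j<q. R (Suc m) $$ (i, j) * Y (Suc m - 1) ([j] @ v @ rev w'))"
    unfolding transform_family_def by blast
  then have "Y (Suc m) (v @ rev w) = (\<Sum>j<q. R (Suc m) $$ (i, j) * Y m ((j # v) @ rev w'))"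
    by (simp add: w)
  also have "\<dots> = (\<Sum>j<q. R (Suc m) $$ (i, j) *
      (\<Sum>u \<in> words q m. word_weight R w' u * Y 0 (u @ j # v)))"
  proof (rule sum.cong[OF refl])
    fix j assume "j \<in> {..<q}"
    then have "j # v \<in> words q (n - m)"
      using Suc.prems(1,2) by (auto simp: words_def)
    then show "R (Suc m) $$ (i, j) * Y m ((j # v) @ rev w') = R (Suc m) $$ (i, j) *
        (\<Sum>u \<in> words q m. word_weight R w' u * Y 0 (u @ j # v))"
      using Suc.IH[of "j # v" w'] Suc.prems(1) w'(1) by simp
  qed
  also have "\<dots> = (\<Sum>u \<in> words q m. \<Sum>j<q.
      word_weight R w' u * R (Suc m) $$ (i, j) * Y 0 (u @ j # v))"
    unfolding sum_distrib_left by (subst sum.swap) (simp add: ac_simps)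
  also have "\<dots> = (\<Sum>u \<in> words q m. \<Sum>j<q. word_weight R w (u @ [j]) * Y 0 ((u @ [j]) @ v))"
    using w'(1) by (intro sum.cong refl) (simp add: w word_weight_snoc words_def)
  also have "\<dots> = (\<Sum>x \<in> words q (Suc m). word_weight R w x * Y 0 (x @ v))"
    by (rule sum_words_Suc[symmetric])
  finally show ?case .
qed

theorem lemma1:
  fixes q n :: nat
    and R :: "nat \<Rightarrow> 'a :: {comm_ring, comm_monoid_mult} mat"
    and X :: "nat list \<Rightarrow> 'a"
    and Y :: "nat \<Rightarrow> nat list \<Rightarrow> 'a"
  assumes "q \<ge> 2" and "n \<ge> 1"
    and "\<And>m. m \<in> {1..n} \<Longrightarrow> R m \<in> carrier_mat q q"
    and "transform_family q n R X Y"
  shows "(\<forall>m \<le> n. \<forall>v \<in> words q (n - m). \<forall>w \<in> words q m.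
            Y m (v @ rev w) = (\<Sum>u \<in> words q m. word_weight R w u * Y 0 (u @ v)))
       \<and> (\<forall>w \<in> words q n. Y n (rev w) = (\<Sum>u \<in> words q n. word_weight R w u * X u))"
proof (intro conjI allI impI ballI)
  fix m v w assume "m \<le> n" "v \<in> words q (n - m)" "w \<in> words q m"
  then show "Y m (v @ rev w) = (\<Sum>u \<in> words q m. word_weight R w u * Y 0 (u @ v))"
    by (rule transform_family_expand[OF assms(4)])
next
  fix w assume "w \<in> words q n"
  then have "Y n (rev w) = (\<Sum>u \<in> words q n. word_weight R w u * Y 0 u)"
    using transform_family_expand[OF assms(4), of n "[]" w] by (simp add: words_0)
  also have "\<dots> = (\<Sum>u \<in> words q n. word_weight R w u * X u)"
    using assms(4) by (intro sum.cong) (auto simp: transform_family_def)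
  finally show "Y n (rev w) = (\<Sum>u \<in> words q n. word_weight R w u * X u)" .
qed

end
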